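(* Let $n\in\mathbb{N}$ and let $F=(F_1,\ldots,F_n)$ be an $n$-tuple of hermitian $3\times 3$ complex matrices. Then every proper face of $L(F)$ is a singleton, a segment, a filled ellipse, or a filled ellipsoid. If a proper face is not a singleton, then it is an exposed face of $L(F)$.
   Context: For an $n$-tuple $F=(F_1,\ldots,F_n)$ of hermitian $3\times3$ complex matrices the joint algebraic numerical range is $$L(F)=\{(\operatorname{tr}(\rho F_1),\ldots,\operatorname{tr}(\rho F_n))\mid \rho\in\mathcal{M}_3\}\subset\mathbb{R}^n,$$ where $\mathcal{M}_3$ is the set of positive semi-definite $3\times 3$ complex matrices of trace one. A face of a convex set $C\subset\mathbb{R}^n$ is a convex subset of $C$ which contains the endpoints of every open segment in $C$ which it intersects; a proper face is a face different from $\emptyset$ and $C$. An exposed face of $C$ is the empty set or the set of maximizers over $C$ of a linear functional. A filled ellipse (resp. filled ellipsoid) is an image of the closed unit ball of $\mathbb{R}^2$ (resp. $\mathbb{R}^3$) under an injective affine map. *)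

theory Defs
  imports "HOL-Analysis.Analysis"
begin

definition hermitian :: "complex^'m^'m \<Rightarrow> bool" where
  "hermitian A \<longleftrightarrow> (\<forall>i j. A $ i $ j = cnj (A $ j $ i))"

definition pos_semidef :: "complex^'m^'m \<Rightarrow> bool" where
  "pos_semidef A \<longleftrightarrow> hermitian A \<and>
     (\<forall>v :: complex^'m. 0 \<le> Re (\<Sum>i\<in>UNIV. cnj (v $ i) * (A *v v) $ i))"

definition density_matrices :: "(complex^'m^'m) set" where
  "density_matrices = {\<rho>. pos_semidef \<rho> \<and> trace \<rho> = 1}"

(* The coordinates of a point are real. Since tr (\<rho> F_i) is real for hermitian \<rho> and F_i,
   every density matrix contributes exactly one point when all F_i are hermitian. *)
definition joint_num_range :: "(complex^'m^'m)^'n \<Rightarrow> (real^'n) set" where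
  "joint_num_range F =
     {x. \<exists>\<rho>\<in>density_matrices. \<forall>i. complex_of_real (x $ i) = trace (\<rho> ** F $ i)}"

definition affine_map :: "('a::real_vector \<Rightarrow> 'b::real_vector) \<Rightarrow> bool" where
  "affine_map f \<longleftrightarrow> (\<exists>g c. linear g \<and> f = (\<lambda>x. g x + c))"

definition filled_ellipse :: "'a::real_vector set \<Rightarrow> bool" where
  "filled_ellipse S \<longleftrightarrow>
     (\<exists>f :: real^2 \<Rightarrow> 'a. affine_map f \<and> inj f \<and> S = f ` cball 0 1)"

definition filled_ellipsoid :: "'a::real_vector set \<Rightarrow> bool" where
  "filled_ellipsoid S \<longleftrightarrow>
     (\<exists>f :: real^3 \<Rightarrow> 'a. affine_map f \<and> inj f \<and> S = f ` cball 0 1)"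

definition proper_face_of :: "'a::real_vector set \<Rightarrow> 'a set \<Rightarrow> bool"
    (infixr "proper'_face'_of" 50) where
  "T proper_face_of S \<longleftrightarrow> T face_of S \<and> T \<noteq> {} \<and> T \<noteq> S"

end

theory Submission
  imports Defs
begin

text \<open>Write \<open>\<pi> \<rho>\<close> for the point with coordinates \<open>tr (\<rho> F\<^sub>i)\<close>, so that the joint numerical range \<open>L\<close> is the
linear image under \<open>\<pi>\<close> of the convex set of density matrices. A proper face \<open>T\<close> of \<open>L\<close> lies in some
proper exposed face \<open>E\<close>, cut out by a supporting hyperplane \<open>a \<bullet> x = b\<close>. Pulled back along \<open>\<pi>\<close>, the
supporting half-space says that the hermitian matrix \<open>H = b 1 - \<Sum>\<^sub>i a\<^sub>i F\<^sub>i\<close> satisfies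
\<open>tr (H \<rho>) \<ge> 0\<close> for every density matrix, that is, \<open>H\<close> is positive semi-definite, and \<open>E\<close> is the image of
the density matrices with \<open>tr (H \<rho>) = 0\<close>. For positive semi-definite matrices this forces
\<open>H \<rho> = 0\<close> (lemma \<open>pos_semidef_mult_eq_0\<close>), so these are the density matrices supported on the kernel of \<open>H\<close>.

As \<open>H \<noteq> 0\<close> is a 3 by 3 matrix and \<open>E\<close> is not empty, the kernel is a line or a plane.
A line supports one density matrix, and
a plane supports a Bloch ball, an affine copy of the unit ball of \<open>\<real>\<^sup>3\<close>. Either way \<open>E\<close> is the
image of the three-dimensional unit ball under an affine map
(lemmas \<open>density_kernel_eq_affine_image_cball\<close> and \<open>exposed_face_eq_affine_image_cball\<close>).

The rest is convex geometry. The set \<open>T\<close> is a face of \<open>E\<close>. Faces of an affine image pull back to faces of the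
ball, which is strictly convex, so \<open>T\<close> is a singleton or \<open>T = E\<close>
(lemma \<open>proper_face_of_affine_image_cball\<close>). This gives exposedness of every face that is not a
singleton. Finally, the image of the unit ball of \<open>\<real>\<^sup>3\<close> under a linear map is the image of the unit
ball of the orthogonal complement of the kernel, on which the map is injective; the dimension 0, 1, 2 or 3
of that complement decides between a point, a segment, a filled ellipse and a filled ellipsoid
(lemma \<open>affine_image_cball3_cases\<close>).\<close>

section \<open>Faces and affine images of balls\<close>

lemma affine_mapE:
  assumes "affine_map f"
  obtains g c where "linear g" "\<And>x. f x = g x + c"
  using assms unfolding affine_map_def by auto

lemma affine_map_convex_comb:
  assumes "affine_map f"
  shows "f ((1 - u) *\<^sub>R x + u *\<^sub>R y) = (1 - u) *\<^sub>R f x + u *\<^sub>R f y"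
proof -
  obtain g c where "linear g" and f: "\<And>x. f x = g x + c"
    using assms by (rule affine_mapE) blast
  then show ?thesis
    by (simp add: f linear_add linear_diff linear_scale scaleR_add_right scaleR_left_diff_distrib)
qed

lemma affine_map_compose:
  assumes "affine_map f" "affine_map h"
  shows "affine_map (\<lambda>x. f (h x))"
proof -
  obtain g c where g: "linear g" "\<And>x. f x = g x + c"
    using assms(1) by (rule affine_mapE) blast
  obtain k d where k: "linear k" "\<And>x. h x = k x + d"
    using assms(2) by (rule affine_mapE) blast
  have "linear (\<lambda>x. g (k x))" "(\<lambda>x. f (h x)) = (\<lambda>x. g (k x) + (g d + c))"
    using g k linear_compose[OF k(1) g(1)] by (auto simp: o_def linear_add)
  then show ?thesis
    unfolding affine_map_def by (intro exI conjI)
qed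

lemma linear_affine_map:
  assumes "linear g"
  shows "affine_map g"
  unfolding affine_map_def
proof (intro exI conjI)
  show "linear g" by fact
  show "g = (\<lambda>x. g x + 0)" by simp
qed

lemma affine_map_const: "affine_map (\<lambda>x. c)"
  unfolding affine_map_def
proof (intro exI conjI)
  show "linear (\<lambda>x. 0)" by (rule linear_zero)
  show "(\<lambda>x. c) = (\<lambda>x. 0 + c)" by simp
qed

lemma face_of_vimage_affine_map:
  assumes f: "affine_map f" and T: "T face_of f ` S" and S: "convex S"
  shows "(S \<inter> f -` T) face_of S"
  unfolding face_of_def
proof (intro conjI ballI impI)
  have convT: "convex T"
    using T by (rule face_of_imp_convex)
  show "convex (S \<inter> f -` T)"
    unfolding convex_alt
  proof (intro ballI allI impI)
    fix x y u assume "x \<in> S \<inter> f -` T" "y \<in> S \<inter> f -` T" "0 \<le> (u::real) \<and> u \<le> 1"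
    then show "(1 - u) *\<^sub>R x + u *\<^sub>R y \<in> S \<inter> f -` T"
      using S convT unfolding convex_alt
      by (auto simp: affine_map_convex_comb[OF f])
  qed
  fix a b x assume a: "a \<in> S" and b: "b \<in> S" and x: "x \<in> S \<inter> f -` T" and seg: "x \<in> open_segment a b"
  obtain u where u: "0 < u" "u < 1" "x = (1 - u) *\<^sub>R a + u *\<^sub>R b"
    using seg by (auto simp: in_segment)
  have fx: "f x = (1 - u) *\<^sub>R f a + u *\<^sub>R f b"
    using u by (simp add: affine_map_convex_comb[OF f])
  have "f a \<in> T \<and> f b \<in> T"
  proof (cases "f a = f b")
    case True
    then have "f x = f a" using fx by (simp add: algebra_simps)
    then show ?thesis using x True by auto
  next
    case False
    then have "f x \<in> open_segment (f a) (f b)"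
      using u fx by (auto simp: in_segment)
    then show ?thesis
      using face_ofD[OF T] a b x by blast
  qed
  then show "a \<in> S \<inter> f -` T" "b \<in> S \<inter> f -` T"
    using a b by auto
qed auto

text \<open>Closed balls are strictly convex: a face that misses the interior contains no two distinct points, because
their midpoint would be an interior point. The preimage of the given face is such a face of the ball.\<close>

lemma proper_face_of_affine_image_cball:
  fixes f :: "'a::euclidean_space \<Rightarrow> 'b::real_vector"
  assumes f: "affine_map f" and T: "T proper_face_of f ` cball c r"
  shows "\<exists>a. T = {a}"
proof -
  let ?G = "cball c r \<inter> f -` T"
  have TS: "T \<subseteq> f ` cball c r" "T \<noteq> {}" "T \<noteq> f ` cball c r" "T face_of f ` cball c r"
    using T face_of_imp_subset by (auto simp: proper_face_of_def)
  have img: "T = f ` ?G"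
    using TS by auto
  have G: "?G face_of cball c r"
    using face_of_vimage_affine_map[OF f TS(4)] by simp
  have "?G \<noteq> cball c r"
    using img TS by auto
  then have dis: "?G \<inter> ball c r = {}"
    using face_of_disjoint_interior[OF G] by simp
  have "x = y" if x: "x \<in> ?G" and y: "y \<in> ?G" for x y
  proof (rule ccontr)
    assume "x \<noteq> y"
    then have m: "midpoint x y \<in> open_segment x y"
      by simp
    then have "midpoint x y \<in> ball c r"
      using dist_decreases_open_segment[OF m, of c] x y by auto
    moreover have "midpoint x y \<in> ?G"
      using face_of_imp_convex[OF G] x y m open_closed_segment
      by (meson closed_segment_subset subsetD)
    ultimately show False using dis by blast
  qed
  moreover obtain x where "x \<in> ?G"
    using img TS by blast
  ultimately have "?G = {x}" by blast
  then show ?thesis using img by (metis image_empty image_insert)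
qed

text \<open>Orthogonal projection onto the complement of the kernel preserves the value of a linear map and does not
increase the norm. Hence the unit ball and its section with that complement have the same image.\<close>

lemma linear_kernel_orthogonal_representative:
  fixes g :: "'a::euclidean_space \<Rightarrow> 'b::real_vector"
  assumes "linear g"
  obtains z where "\<And>y. g y = 0 \<Longrightarrow> orthogonal y z" "g z = g x" "norm z \<le> norm x"
proof -
  interpret g: linear g by fact
  have span: "span {x. g x = 0} = {x. g x = 0}"
    using linear_subspace_kernel[OF assms] by (simp add: span_eq_iff)
  obtain y z where "y \<in> {x. g x = 0}" and z: "\<And>w. w \<in> {x. g x = 0} \<Longrightarrow> orthogonal z w"
    and x: "x = y + z"
    by (rule orthogonal_subspace_decomp_exists[of "{x. g x = 0}" x, unfolded span]) (rule that)
  then have y: "g y = 0" by simp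
  have "(norm x)\<^sup>2 = (norm y)\<^sup>2 + (norm z)\<^sup>2"
    unfolding x using z y by (simp add: norm_add_Pythagorean orthogonal_commute)
  then have "norm z \<le> norm x"
    by (simp add: power2_le_imp_le)
  then show thesis
    using that[of z] z y x by (simp add: g.add orthogonal_commute)
qed

text \<open>The type variable \<open>'k\<close> supplies a Euclidean space with the dimension of the orthogonal complement of the
kernel. It is identified isometrically with that complement, so its unit ball goes to the section of the ball.\<close>

lemma affine_image_cball_eq_inj_image:
  fixes f :: "'a::euclidean_space \<Rightarrow> 'b::real_vector"
  assumes "linear g" and f: "\<And>x. f x = g x + c"
    and dimk: "DIM('k::euclidean_space) = dim {y. \<forall>x \<in> {x. g x = 0}. orthogonal x y}"
  shows "\<exists>h :: 'k \<Rightarrow> 'b. affine_map h \<and> inj h \<and> h ` cball 0 1 = f ` cball 0 1"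
proof -
  interpret g: linear g by fact
  let ?K = "{x. g x = 0}"
  let ?P = "{y. \<forall>x \<in> ?K. orthogonal x y}"
  have subP: "subspace ?P"
    by (rule subspace_orthogonal_to_vectors)
  have "dim (UNIV :: 'k set) = dim ?P"
    using dimk by (simp add: dim_UNIV)
  then obtain h where h: "linear h" "h ` (UNIV :: 'k set) = ?P" "\<And>x. x \<in> UNIV \<Longrightarrow> norm (h x) = norm x"
    by (rule isometries_subspaces[OF subspace_UNIV subP]) (rule that, assumption, assumption, simp)
  have inj: "inj (\<lambda>x. f (h x))"
  proof (rule injI)
    fix x y assume "f (h x) = f (h y)"
    then have "h (x - y) \<in> ?K"
      by (simp add: f linear_diff[OF h(1)] g.diff)
    moreover have "h (x - y) \<in> ?P"
      using h(2) by blast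
    ultimately have "h (x - y) = 0"
      by (auto simp: orthogonal_self)
    then have "norm (x - y) = 0"
      using h(3)[of "x - y"] by simp
    then show "x = y" by simp
  qed
  have aff: "affine_map f"
    unfolding affine_map_def using \<open>linear g\<close> f by blast
  have "f ` cball 0 1 \<subseteq> (\<lambda>x. f (h x)) ` cball 0 1"
  proof clarify
    fix x :: 'a assume x: "x \<in> cball 0 1"
    obtain z where z: "\<And>y. g y = 0 \<Longrightarrow> orthogonal y z" "g z = g x" "norm z \<le> norm x"
      by (rule linear_kernel_orthogonal_representative[OF \<open>linear g\<close>, of x]) (rule that)
    then have "z \<in> ?P" by blast
    then obtain t where t: "z = h t" using h(2) by blast
    then have "t \<in> cball 0 1" using z(3) x h(3)[of t] by simp
    moreover have "f x = f (h t)" using z(2) t by (simp add: f)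
    ultimately show "f x \<in> (\<lambda>x. f (h x)) ` cball 0 1" by blast
  qed
  moreover have "(\<lambda>x. f (h x)) ` cball 0 1 \<subseteq> f ` cball 0 1"
    using h(3) by auto
  ultimately show ?thesis
    using inj affine_map_compose[OF aff linear_affine_map[OF h(1)]] by blast
qed

lemma affine_image_cball3_cases:
  fixes f :: "real^3 \<Rightarrow> 'b::real_vector"
  assumes "affine_map f"
  shows "(\<exists>a. f ` cball 0 1 = {a}) \<or> (\<exists>a b. a \<noteq> b \<and> f ` cball 0 1 = closed_segment a b) \<or>
    filled_ellipse (f ` cball 0 1) \<or> filled_ellipsoid (f ` cball 0 1)"
proof -
  obtain g c where g: "linear g" and f: "\<And>x. f x = g x + c"
    using assms by (rule affine_mapE) blast
  let ?P = "{y. \<forall>x \<in> {x. g x = 0}. orthogonal x y}"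
  have "dim ?P \<le> 3"
    using dim_subset_UNIV[of ?P] by simp
  then consider "dim ?P = 0" | "dim ?P = 1" | "dim ?P = 2" | "dim ?P = 3"
    by linarith
  then show ?thesis
  proof cases
    case 1
    then have P0: "?P \<subseteq> {0}" by (simp add: dim_eq_0)
    have "g x = 0" for x
    proof -
      obtain z where "\<And>y. g y = 0 \<Longrightarrow> orthogonal y z" "g z = g x"
        by (rule linear_kernel_orthogonal_representative[OF g, of x]) (rule that)
      moreover from this have "z = 0" using P0 by blast
      ultimately show ?thesis using linear_0[OF g] by simp
    qed
    then have "f ` cball 0 1 = {c}" by (simp add: f image_constant_conv)
    then show ?thesis by blast
  next
    case 2
    obtain h :: "real \<Rightarrow> 'b" where h: "affine_map h" "inj h" "h ` cball 0 1 = f ` cball 0 1"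
      using affine_image_cball_eq_inj_image[OF g f, where 'k = real] 2 by auto
    obtain k d where k: "linear k" "\<And>x. h x = k x + d"
      using h(1) by (rule affine_mapE) blast
    have "cball 0 1 = closed_segment (-1) (1::real)"
      by (auto simp: closed_segment_eq_real_ivl)
    then have "h ` cball 0 1 = (+) d ` k ` closed_segment (-1) 1"
      by (simp add: k(2) image_image add.commute)
    also have "\<dots> = closed_segment (h (-1)) (h 1)"
      using closed_segment_linear_image[OF k(1), of "-1" 1] closed_segment_translation[of d "k (-1)" "k 1"]
      by (simp add: k(2) add.commute)
    finally have "f ` cball 0 1 = closed_segment (h (-1)) (h 1)"
      using h(3) by simp
    moreover have "h (-1) \<noteq> h 1"
      using h(2) by (auto dest: injD)
    ultimately show ?thesis by blast
  next
    case 3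
    then have "DIM(real^2) = dim ?P" by simp
    from affine_image_cball_eq_inj_image[OF g f this]
    obtain h :: "real^2 \<Rightarrow> 'b" where "affine_map h" "inj h" "h ` cball 0 1 = f ` cball 0 1"
      by blast
    then have "filled_ellipse (f ` cball 0 1)"
      unfolding filled_ellipse_def by metis
    then show ?thesis by blast
  next
    case 4
    then have "DIM(real^3) = dim ?P" by simp
    from affine_image_cball_eq_inj_image[OF g f this]
    obtain h :: "real^3 \<Rightarrow> 'b" where "affine_map h" "inj h" "h ` cball 0 1 = f ` cball 0 1"
      by blast
    then have "filled_ellipsoid (f ` cball 0 1)"
      unfolding filled_ellipsoid_def by metis
    then show ?thesis by blast
  qed
qed

text \<open>A relative interior point of \<open>T\<close> lies on the relative boundary of \<open>S\<close>, so a hyperplane supports \<open>S\<close>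
there without containing \<open>S\<close>. The exposed face that it cuts out contains a relative interior point of \<open>T\<close>,
and therefore all of \<open>T\<close>.\<close>

lemma proper_face_subset_proper_exposed_face:
  fixes S :: "'a::euclidean_space set"
  assumes S: "convex S" and T: "T proper_face_of S"
  obtains a b where "S \<subseteq> {x. a \<bullet> x \<le> b}" "T \<subseteq> {x. a \<bullet> x = b}" "\<not> S \<subseteq> {x. a \<bullet> x = b}"
proof -
  have T': "T face_of S" "T \<noteq> {}" "T \<noteq> S" "T \<subseteq> S"
    using T face_of_imp_subset by (auto simp: proper_face_of_def)
  have "rel_interior T \<noteq> {}"
    using rel_interior_eq_empty face_of_imp_convex[OF T'(1)] T'(2) by blast
  then obtain x where x: "x \<in> rel_interior T" by blast
  then have "x \<in> T" using rel_interior_subset by blast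
  then have "x \<in> S" "x \<notin> rel_interior S"
    using T' face_of_disjoint_rel_interior[OF T'(1,3)] by auto
  then obtain c where c: "\<And>y. y \<in> S \<Longrightarrow> c \<bullet> x \<le> c \<bullet> y" "\<And>y. y \<in> rel_interior S \<Longrightarrow> c \<bullet> x < c \<bullet> y"
    by (rule supporting_hyperplane_rel_boundary[OF S]) (rule that)
  have "c \<bullet> x \<le> c \<bullet> y" if "y \<in> S" for y
    using c(1) that by blast
  then have le: "- c \<bullet> y \<le> - c \<bullet> x" if "y \<in> S" for y
    using that by simp
  have "(S \<inter> {y. - c \<bullet> y = - c \<bullet> x}) face_of S"
    by (rule face_of_Int_supporting_hyperplane_le[OF S le])
  then have "T \<subseteq> S \<inter> {y. - c \<bullet> y = - c \<bullet> x}"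
    using subset_of_face_of T'(4) x \<open>x \<in> S\<close> by blast
  moreover obtain y where "y \<in> rel_interior S"
    using rel_interior_eq_empty S \<open>x \<in> S\<close> by blast
  then have "y \<in> S" "- c \<bullet> y \<noteq> - c \<bullet> x"
    using c(2) rel_interior_subset by force+
  ultimately show thesis
    using that[of "- c" "- c \<bullet> x"] le by blast
qed

section \<open>Hermitian forms and positive semi-definite matrices\<close>

definition cinner :: "complex^'m \<Rightarrow> complex^'m \<Rightarrow> complex" where
  "cinner u v = (\<Sum>i\<in>UNIV. cnj (u $ i) * v $ i)"

definition outer :: "complex^'m \<Rightarrow> complex^'m \<Rightarrow> complex^'m^'m" where
  "outer u v = (\<chi> i j. u $ i * cnj (v $ j))"

lemma cinner_add_left: "cinner (u + v) w = cinner u w + cinner v w"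
  and cinner_add_right: "cinner w (u + v) = cinner w u + cinner w v"
  and cinner_diff_left: "cinner (u - v) w = cinner u w - cinner v w"
  and cinner_diff_right: "cinner w (u - v) = cinner w u - cinner w v"
  by (simp_all add: cinner_def sum.distrib sum_subtractf algebra_simps)

lemma cinner_scale_left: "cinner (a *s u) v = cnj a * cinner u v"
  and cinner_scale_right: "cinner u (a *s v) = a * cinner u v"
  by (simp_all add: cinner_def sum_distrib_left algebra_simps)

lemma cinner_zero [simp]: "cinner 0 v = 0" "cinner u 0 = 0"
  by (simp_all add: cinner_def)

lemmas cinner_simps = cinner_add_left cinner_add_right cinner_diff_left cinner_diff_right
  cinner_scale_left cinner_scale_right

lemma cnj_cinner [simp]: "cnj (cinner u v) = cinner v u"
  by (simp add: cinner_def mult.commute)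

lemma cinner_self: "cinner v v = complex_of_real ((norm v)\<^sup>2)"
  by (simp add: cinner_def norm_vec_def L2_set_def sum_nonneg complex_norm_square mult.commute
      del: of_real_power)

lemma cinner_axis: "cinner (axis i 1) v = v $ i"
  by (simp add: cinner_def axis_def if_distrib[of cnj] if_distrib[of "\<lambda>x. x * _"] cong: if_cong)

lemma hermitian_cnj: "hermitian A \<Longrightarrow> cnj (A $ i $ j) = A $ j $ i"
  unfolding hermitian_def by (metis complex_cnj_cnj)

lemma matrix_entry_eq_cinner: "A $ i $ j = cinner (axis i 1) (A *v axis j 1)"
  unfolding cinner_axis
  by (simp add: matrix_vector_mult_def axis_def if_distrib[of "\<lambda>x. _ * x"] cong: if_cong)

lemma cinner_hermitian:
  assumes "hermitian A"
  shows "cinner (A *v u) v = cinner u (A *v v)"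
proof -
  have "cnj (A $ i $ j) = A $ j $ i" for i j
    using assms by (rule hermitian_cnj)
  then have "cinner (A *v u) v = (\<Sum>i\<in>UNIV. \<Sum>j\<in>UNIV. cnj (u $ j) * A $ j $ i * v $ i)"
    by (simp add: cinner_def matrix_vector_mult_def sum_distrib_left mult_ac)
  also have "\<dots> = cinner u (A *v v)"
    by (subst sum.swap)
      (simp add: cinner_def matrix_vector_mult_def sum_distrib_left mult_ac)
  finally show ?thesis .
qed

lemma hermitianI:
  assumes "\<And>u v. cinner (A *v u) v = cinner u (A *v v)"
  shows "hermitian A"
  unfolding hermitian_def
proof (intro allI)
  fix i j
  have "A $ i $ j = cinner (axis i 1) (A *v axis j 1)"
    by (rule matrix_entry_eq_cinner)
  also have "\<dots> = cinner (A *v axis i 1) (axis j 1)"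
    by (simp add: assms)
  also have "\<dots> = cnj (cinner (axis j 1) (A *v axis i 1))"
    by simp
  also have "\<dots> = cnj (A $ j $ i)"
    unfolding matrix_entry_eq_cinner[of A j i] ..
  finally show "A $ i $ j = cnj (A $ j $ i)" .
qed

lemma pos_semidef_iff:
  "pos_semidef A \<longleftrightarrow> hermitian A \<and> (\<forall>v. 0 \<le> Re (cinner v (A *v v)))"
  by (simp add: pos_semidef_def cinner_def)

lemma pos_semidef_imp_hermitian: "pos_semidef A \<Longrightarrow> hermitian A"
  and pos_semidef_form_nonneg: "pos_semidef A \<Longrightarrow> 0 \<le> Re (cinner v (A *v v))"
  by (simp_all add: pos_semidef_iff)

lemma hermitian_form_real:
  assumes "hermitian A"
  shows "cinner v (A *v v) = complex_of_real (Re (cinner v (A *v v)))"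
proof -
  have "cnj (cinner v (A *v v)) = cinner v (A *v v)"
    using cinner_hermitian[OF assms, of v v] by simp
  then show ?thesis
    by (metis Reals_cnj_iff of_real_Re)
qed

text \<open>The usual discriminant argument: the form is evaluated at \<open>s u - r c\<^sup>* v\<close> for real \<open>s\<close> and \<open>r\<close>,
where \<open>c\<close> is the mixed term, so that all terms become real.\<close>

lemma pos_semidef_Cauchy_Schwarz:
  assumes "pos_semidef A"
  shows "(cmod (cinner u (A *v v)))\<^sup>2 \<le> Re (cinner u (A *v u)) * Re (cinner v (A *v v))"
proof -
  note herm = pos_semidef_imp_hermitian[OF assms] and nonneg = pos_semidef_form_nonneg[OF assms]
  define a b c where "a = Re (cinner u (A *v u))" and "b = Re (cinner v (A *v v))"
    and "c = cinner u (A *v v)"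
  have c': "cinner v (A *v u) = cnj c"
    using cinner_hermitian[OF herm, of u v] cnj_cinner[of "A *v u" v] by (simp add: c_def)
  have expand: "cinner (p *s u + t *s v) (A *v (p *s u + t *s v)) =
      cnj p * p * complex_of_real a + cnj p * t * c + cnj t * p * cnj c + cnj t * t * complex_of_real b"
    for p t
    using hermitian_form_real[OF herm, of u] hermitian_form_real[OF herm, of v]
    by (simp add: matrix_vector_right_distrib vector_scalar_commute cinner_simps c' a_def b_def
        flip: c_def) (simp add: algebra_simps)
  have quad: "0 \<le> s\<^sup>2 * a + (cmod c)\<^sup>2 * r\<^sup>2 * b - 2 * s * r * (cmod c)\<^sup>2" for s r
  proof -
    let ?x = "complex_of_real s *s u + (- complex_of_real r * cnj c) *s v"
    have "cinner ?x (A *v ?x) = complex_of_real s * complex_of_real s * complex_of_real a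
        + c * cnj c * complex_of_real r * complex_of_real r * complex_of_real b
        - 2 * complex_of_real s * complex_of_real r * (c * cnj c)"
      unfolding expand by (simp add: algebra_simps)
    also have "\<dots> = complex_of_real (s\<^sup>2 * a + (cmod c)\<^sup>2 * r\<^sup>2 * b - 2 * s * r * (cmod c)\<^sup>2)"
      unfolding complex_norm_square[symmetric] by (simp add: power2_eq_square)
    finally have "cinner ?x (A *v ?x) = \<dots>" .
    then show ?thesis
      using nonneg[of ?x] by (metis Re_complex_of_real)
  qed
  have "(cmod c)\<^sup>2 \<le> a * b"
  proof (cases "b = 0")
    case True
    have "(cmod c)\<^sup>2 = 0"
    proof (rule ccontr)
      assume "(cmod c)\<^sup>2 \<noteq> 0"
      then show False
        \<comment> \<open>The form is affine in \<open>r\<close> with slope \<open>-2 \<bar>c\<bar>\<^sup>2\<close>; this \<open>r\<close> gives it the value \<open>-1\<close>.\<close>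
        using quad[of 1 "(a + 1) / (2 * (cmod c)\<^sup>2)"] True by (simp add: field_simps)
    qed
    then show ?thesis using True by simp
  next
    case False
    then have "b > 0" using nonneg[of v] by (simp add: b_def)
    moreover have "0 \<le> b * (a * b - (cmod c)\<^sup>2)"
      using quad[of b 1] by (simp add: algebra_simps power2_eq_square)
    ultimately show ?thesis by (simp add: zero_le_mult_iff)
  qed
  then show ?thesis by (simp add: a_def b_def c_def)
qed

lemma outer_mult_vec: "outer u v *v x = cinner v x *s u"
  by (simp add: outer_def cinner_def matrix_vector_mult_def vec_eq_iff sum_distrib_left
      sum_distrib_right mult_ac)

lemma matrix_mult_outer: "A ** outer u v = outer (A *v u) v"
  by (simp add: outer_def matrix_matrix_mult_def matrix_vector_mult_def vec_eq_iff
      sum_distrib_right sum_distrib_left mult_ac)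

lemma trace_outer: "trace (outer u v) = cinner v u"
  by (simp add: trace_def outer_def cinner_def mult.commute)

lemma trace_outer_mult: "trace (A ** outer u v) = cinner v (A *v u)"
  by (simp add: matrix_mult_outer trace_outer)

text \<open>Cholesky's decomposition, which needs no eigenvectors: subtracting the rank one matrix built from a column
with nonzero diagonal entry \<open>d\<close> leaves a Schur complement. It is positive semi-definite by the
Cauchy--Schwarz inequality and has strictly fewer nonzero diagonal entries. When the whole diagonal vanishes,
the Cauchy--Schwarz inequality makes the matrix zero.\<close>

lemma pos_semidef_eq_sum_outer:
  fixes A :: "complex^'m^'m"
  assumes "pos_semidef A"
  shows "\<exists>us. A = (\<Sum>u\<leftarrow>us. outer u u)"
  using assms
proof (induction "card {i. A $ i $ i \<noteq> 0}" arbitrary: A rule: less_induct)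
  case less
  note herm = pos_semidef_imp_hermitian[OF less.prems] and nonneg = pos_semidef_form_nonneg[OF less.prems]
  note entry = matrix_entry_eq_cinner[of A]
  have col: "(A *v axis j 1) $ i = A $ i $ j" for i j
    unfolding entry cinner_axis ..
  have CS: "(cmod (A $ i $ j))\<^sup>2 \<le> Re (A $ i $ i) * Re (A $ j $ j)" for i j
    unfolding entry by (rule pos_semidef_Cauchy_Schwarz) fact
  have zero_row: "A $ i $ j = 0" if "A $ i $ i = 0" for i j
    using CS[of i j] that by simp
  show ?case
  proof (cases "\<exists>i. A $ i $ i \<noteq> 0")
    case False
    then have "A = 0" using zero_row by (simp add: vec_eq_iff)
    then have "A = (\<Sum>u\<leftarrow>[]. outer u u)" by simp
    then show ?thesis by blast
  next
    case True
    then obtain i where i: "A $ i $ i \<noteq> 0" by blast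
    define d where "d = Re (A $ i $ i)"
    have Aii: "A $ i $ i = complex_of_real d"
      using hermitian_form_real[OF herm, of "axis i 1"] by (simp add: d_def entry)
    have "d \<ge> 0" using nonneg[of "axis i 1"] by (simp add: d_def entry)
    then have d: "d > 0" using i Aii by (cases "d = 0") auto
    define u where "u = complex_of_real (1 / sqrt d) *s (A *v axis i 1)"
    define B where "B = A - outer u u"
    have Bv: "cinner x (B *v y) = cinner x (A *v y) - cinner x u * cinner u y" for x y
      by (simp add: B_def matrix_vector_mult_diff_rdistrib outer_mult_vec cinner_simps)
    have Bh: "hermitian B"
    proof (rule hermitianI)
      fix x y
      have "cinner (B *v x) y = cnj (cinner y (B *v x))" by simp
      also have "\<dots> = cinner (A *v x) y - cinner x u * cinner u y"
        by (simp only: Bv) (simp add: mult.commute)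
      finally show "cinner (B *v x) y = cinner x (B *v y)"
        by (simp add: Bv cinner_hermitian[OF herm])
    qed
    have "0 \<le> Re (cinner v (B *v v))" for v
    proof -
      have "cinner v (B *v v) = cinner v (A *v v) - cinner v u * cnj (cinner v u)"
        by (simp add: Bv)
      also have "\<dots> = cinner v (A *v v) - complex_of_real ((cmod (cinner v u))\<^sup>2)"
        by (simp only: complex_norm_square)
      finally have "Re (cinner v (B *v v)) = Re (cinner v (A *v v)) - (cmod (cinner v u))\<^sup>2"
        by simp
      moreover have "(cmod (cinner v u))\<^sup>2 = (cmod (cinner v (A *v axis i 1)))\<^sup>2 / d"
        using d by (simp add: u_def cinner_simps norm_mult norm_divide power_mult_distrib power_divide)
      moreover have "\<dots> \<le> Re (cinner v (A *v v))"
        using pos_semidef_Cauchy_Schwarz[OF less.prems, of v "axis i 1"] d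
        by (simp add: d_def[symmetric] entry[symmetric] field_simps)
      ultimately show ?thesis by simp
    qed
    then have B: "pos_semidef B" using Bh by (simp add: pos_semidef_iff)
    have Bentry: "B $ j $ k = A $ j $ k - A $ j $ i * cnj (A $ k $ i) / complex_of_real d" for j k
    proof -
      have "complex_of_real (1 / sqrt d) * complex_of_real (1 / sqrt d) = complex_of_real (1 / d)"
        using d by (simp flip: of_real_mult)
      then have "u $ j * cnj (u $ k) = complex_of_real (1 / d) * (A $ j $ i * cnj (A $ k $ i))"
        unfolding u_def vector_smult_component col complex_cnj_mult complex_cnj_complex_of_real
        by (metis mult.assoc mult.left_commute)
      then show ?thesis by (simp add: B_def outer_def)
    qed
    have "{j. B $ j $ j \<noteq> 0} \<subset> {j. A $ j $ j \<noteq> 0}"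
    proof
      show "{j. B $ j $ j \<noteq> 0} \<subseteq> {j. A $ j $ j \<noteq> 0}"
      proof clarify
        fix j assume "B $ j $ j \<noteq> 0" and j: "A $ j $ j = 0"
        then show False
          unfolding Bentry zero_row[OF j] by simp
      qed
      show "{j. B $ j $ j \<noteq> 0} \<noteq> {j. A $ j $ j \<noteq> 0}"
      proof
        assume "{j. B $ j $ j \<noteq> 0} = {j. A $ j $ j \<noteq> 0}"
        then have "B $ i $ i \<noteq> 0" using i by blast
        then show False using d by (simp add: Bentry Aii)
      qed
    qed
    then have "card {j. B $ j $ j \<noteq> 0} < card {j. A $ j $ j \<noteq> 0}"
      by (simp add: psubset_card_mono)
    from less.hyps[OF this B] obtain us where "B = (\<Sum>u\<leftarrow>us. outer u u)" by blast
    then have "A = (\<Sum>u\<leftarrow>u # us. outer u u)" by (simp add: B_def algebra_simps)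
    then show ?thesis by blast
  qed
qed

lemma trace_mult_sum_outer:
  "trace (A ** (\<Sum>u\<leftarrow>us. outer u u)) = (\<Sum>u\<leftarrow>us. cinner u (A *v u))"
proof (induction us)
  case Nil
  then show ?case by (simp add: trace_def)
next
  case (Cons u us)
  then show ?case by (simp add: matrix_add_ldistrib trace_add trace_outer_mult)
qed

text \<open>With \<open>B = \<Sum> u u\<^sup>*\<close> the trace is the sum of the nonnegative numbers \<open>u\<^sup>* A u\<close>. If it vanishes, each
term does, and \<open>u\<^sup>* A u = 0\<close> implies \<open>A u = 0\<close> by the Cauchy--Schwarz inequality.\<close>

lemma pos_semidef_mult_eq_0:
  assumes A: "pos_semidef A" and B: "pos_semidef B" and tr: "Re (trace (A ** B)) = 0"
  shows "A ** B = 0"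
proof -
  obtain us where us: "B = (\<Sum>u\<leftarrow>us. outer u u)"
    using pos_semidef_eq_sum_outer[OF B] by blast
  note nonneg = pos_semidef_form_nonneg[OF A]
  have ker: "A *v u = 0" if "Re (cinner u (A *v u)) = 0" for u
  proof -
    have "(cmod (cinner (A *v u) (A *v u)))\<^sup>2 \<le> 0"
      using pos_semidef_Cauchy_Schwarz[OF A, of "A *v u" u] that by simp
    then show ?thesis by (simp add: cinner_self)
  qed
  have "Re (\<Sum>u\<leftarrow>us. cinner u (A *v u)) = (\<Sum>u\<leftarrow>us. Re (cinner u (A *v u)))" for us :: "(complex^'a) list"
    by (induction us) auto
  then have "(\<Sum>u\<leftarrow>us. Re (cinner u (A *v u))) = 0"
    using tr by (simp add: us trace_mult_sum_outer)
  then have "\<forall>u\<in>set us. Re (cinner u (A *v u)) = 0"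
    using nonneg by (subst (asm) sum_list_nonneg_eq_0_iff) auto
  then have "\<forall>u\<in>set us. A *v u = 0" using ker by blast
  then have "A ** (\<Sum>u\<leftarrow>us. outer u u) = 0"
  proof (induction us)
    case (Cons u us)
    then show ?case
      by (simp add: matrix_add_ldistrib matrix_mult_outer) (simp add: outer_def vec_eq_iff)
  qed simp
  then show ?thesis by (simp add: us)
qed

section \<open>Density matrices supported on the kernel of a positive semi-definite matrix\<close>

lemma outer_self_density:
  assumes "cinner e e = 1"
  shows "outer e e \<in> density_matrices"
proof -
  have "hermitian (outer e e)"
    by (simp add: hermitian_def outer_def mult.commute)
  moreover have "0 \<le> Re (cinner v (outer e e *v v))" for v
  proof -
    have "cinner v (outer e e *v v) = cinner e v * cnj (cinner e v)"
      by (simp add: outer_mult_vec cinner_simps)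
    also have "\<dots> = complex_of_real ((cmod (cinner e v))\<^sup>2)"
      by (simp only: complex_norm_square)
    finally show ?thesis by simp
  qed
  ultimately show ?thesis
    using assms by (simp add: density_matrices_def pos_semidef_iff trace_outer)
qed

lemma unit_multiple:
  assumes "v \<noteq> 0"
  obtains e r where "0 < r" "v = complex_of_real r *s e" "cinner e e = 1"
proof
  let ?e = "complex_of_real (1 / norm v) *s v"
  show "0 < norm v" using assms by simp
  show "v = complex_of_real (norm v) *s ?e"
    using assms by (simp add: vec_eq_iff)
  have "cinner ?e ?e = complex_of_real (1 / norm v) * complex_of_real (1 / norm v) * complex_of_real ((norm v)\<^sup>2)"
    unfolding cinner_scale_left cinner_scale_right complex_cnj_complex_of_real cinner_self[of v]
    by (simp only: mult.assoc)
  also have "\<dots> = complex_of_real (1 / norm v * (1 / norm v) * (norm v)\<^sup>2)"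
    by (simp only: of_real_mult)
  also have "1 / norm v * (1 / norm v) * (norm v)\<^sup>2 = 1"
    using assms by (simp add: power2_eq_square)
  finally show "cinner ?e ?e = 1" by simp
qed

text \<open>The cone of positive semi-definite matrices is self-dual; testing against the pure states \<open>e e\<^sup>*\<close> suffices
for this half of the duality.\<close>

lemma pos_semidefI_density:
  assumes herm: "hermitian A" and nonneg: "\<And>\<rho>. \<rho> \<in> density_matrices \<Longrightarrow> 0 \<le> Re (trace (A ** \<rho>))"
  shows "pos_semidef A"
  unfolding pos_semidef_iff
proof (intro conjI allI)
  show "hermitian A" by fact
  fix v
  show "0 \<le> Re (cinner v (A *v v))"
  proof (cases "v = 0")
    case False
    then obtain e r where e: "0 < r" "v = complex_of_real r *s e" "cinner e e = 1"
      by (rule unit_multiple)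
    have "cinner v (A *v v) = complex_of_real (r * r) * trace (A ** outer e e)"
      by (simp add: e(2) vector_scalar_commute cinner_simps trace_outer_mult)
    then have "Re (cinner v (A *v v)) = r * r * Re (trace (A ** outer e e))"
      by (simp del: of_real_mult)
    then show ?thesis
      using nonneg[OF outer_self_density[OF e(3)]] by simp
  qed simp
qed

text \<open>Orthonormality says that the matrix with rows \<open>e\<^sub>i\<^sup>*\<close> is a left inverse of the one with columns
\<open>e\<^sub>i\<close>; for square matrices it is then also a right inverse, and that is completeness.\<close>

lemma orthonormal_expansion:
  fixes e :: "'m \<Rightarrow> complex^'m"
  assumes ortho: "\<And>i j. cinner (e i) (e j) = (if i = j then 1 else 0)"
  shows "v = (\<Sum>i\<in>UNIV. cinner (e i) v *s e i)"
proof -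
  define U :: "complex^'m^'m" where "U = (\<chi> i j. cnj (e i $ j))"
  define V :: "complex^'m^'m" where "V = (\<chi> i j. e j $ i)"
  have "U ** V = mat 1"
    using ortho by (simp add: U_def V_def matrix_matrix_mult_def mat_def vec_eq_iff cinner_def)
  then have "V ** U = mat 1"
    by (simp add: matrix_left_right_inverse)
  then have "v = V *v (U *v v)"
    by (simp add: matrix_vector_mul_assoc)
  also have "U *v v = (\<chi> i. cinner (e i) v)"
    by (simp add: U_def matrix_vector_mult_def cinner_def)
  also have "V *v \<dots> = (\<Sum>i\<in>UNIV. cinner (e i) v *s e i)"
    by (simp add: V_def matrix_vector_mult_def vec_eq_iff mult.commute)
  finally show ?thesis .
qed

lemma orthonormal_expansion_3:
  fixes w p q :: "complex^3"
  assumes "cinner w w = 1" "cinner p p = 1" "cinner q q = 1"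
    and "cinner w p = 0" "cinner w q = 0" "cinner p q = 0"
  shows "v = cinner w v *s w + cinner p v *s p + cinner q v *s q"
proof -
  have sym: "cinner p w = 0" "cinner q w = 0" "cinner q p = 0"
    using assms cnj_cinner[of w p] cnj_cinner[of w q] cnj_cinner[of p q] by simp_all
  define e :: "3 \<Rightarrow> complex^3" where "e i = (if i = 1 then w else if i = 2 then p else q)" for i
  have "\<forall>i j. cinner (e i) (e j) = (if i = j then 1 else 0)"
    unfolding forall_3 by (simp add: e_def assms sym)
  then have "v = (\<Sum>i\<in>UNIV. cinner (e i) v *s e i)"
    by (intro orthonormal_expansion) blast
  then show ?thesis by (simp add: sum_3 e_def)
qed

text \<open>The kernel of a hermitian matrix is orthogonal to its range. A unit vector \<open>w\<close> in the range and two
orthonormal vectors of the kernel form an orthonormal basis of \<open>\<complex>\<^sup>3\<close>, so the kernel is spanned by at most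
two vectors. The expansions record which density matrices are supported on the kernel.\<close>

lemma kernel_hermitian_3_cases:
  fixes H :: "complex^3^3"
  assumes herm: "hermitian H" and "H \<noteq> 0" and u: "H *v u = 0" "u \<noteq> 0"
  obtains (line) p where "cinner p p = 1" "H *v p = 0"
      "\<And>v. H *v v = 0 \<Longrightarrow> v = cinner p v *s p"
  | (plane) p q where "cinner p p = 1" "cinner q q = 1" "cinner p q = 0" "H *v p = 0" "H *v q = 0"
      "\<And>v. H *v v = 0 \<Longrightarrow> v = cinner p v *s p + cinner q v *s q"
proof -
  have "\<exists>x. H *v x \<noteq> 0"
    using \<open>H \<noteq> 0\<close> matrix_eq[of H 0] by auto
  then obtain x where "H *v x \<noteq> 0" by blast
  then obtain w r where w: "0 < r" "H *v x = complex_of_real r *s w" "cinner w w = 1"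
    by (rule unit_multiple)
  have wker: "cinner w v = 0" if "H *v v = 0" for v
  proof -
    have "complex_of_real r * cinner w v = cinner (H *v x) v"
      by (simp add: w(2) cinner_simps)
    also have "\<dots> = 0"
      using cinner_hermitian[OF herm, of x v] that by simp
    finally show ?thesis using w(1) by simp
  qed
  obtain p s where p: "0 < s" "u = complex_of_real s *s p" "cinner p p = 1"
    using u(2) by (rule unit_multiple)
  have Hp: "H *v p = 0"
    using u(1) p(1) by (auto simp: p(2) vector_scalar_commute)
  show thesis
  proof (cases "\<forall>v. H *v v = 0 \<longrightarrow> v = cinner p v *s p")
    case True
    then show thesis using line p(3) Hp by blast
  next
    case False
    then obtain v where v: "H *v v = 0" "v \<noteq> cinner p v *s p" by blast
    then have "v - cinner p v *s p \<noteq> 0" by simp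
    then obtain q t where q: "0 < t" "v - cinner p v *s p = complex_of_real t *s q" "cinner q q = 1"
      by (rule unit_multiple)
    have "complex_of_real t *s (H *v q) = 0"
      unfolding vector_scalar_commute[symmetric] q(2)[symmetric]
      by (simp add: matrix_vector_mult_diff_distrib vector_scalar_commute v(1) Hp)
    then have Hq: "H *v q = 0" using q(1) by simp
    have "complex_of_real t * cinner p q = 0"
      unfolding cinner_scale_right[symmetric] q(2)[symmetric] by (simp add: cinner_simps p(3))
    then have pq: "cinner p q = 0" using q(1) by simp
    have "y = cinner p y *s p + cinner q y *s q" if "H *v y = 0" for y
      using orthonormal_expansion_3[OF w(3) p(3) q(3) wker[OF Hp] wker[OF Hq] pq, of y] wker[OF that]
      by simp
    then show thesis using plane p(3) q(3) pq Hp Hq by blast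
  qed
qed

lemma density_supported_on_line:
  assumes "\<rho> \<in> density_matrices" and "cinner p p = 1" and supp: "\<And>v. \<rho> *v v = cinner p (\<rho> *v v) *s p"
  shows "\<rho> = outer p p"
proof -
  have herm: "hermitian \<rho>" and tr: "trace \<rho> = 1"
    using assms(1) by (auto simp: density_matrices_def pos_semidef_iff)
  define a where "a = cinner p (\<rho> *v p)"
  have "cnj a = a"
    using cinner_hermitian[OF herm, of p p] by (simp add: a_def)
  have "\<rho> *v v = outer (a *s p) p *v v" for v
  proof -
    have "\<rho> *v v = cinner (\<rho> *v p) v *s p"
      using supp[of v] by (simp add: cinner_hermitian[OF herm])
    also have "cinner (\<rho> *v p) v = a * cinner p v"
      using \<open>cnj a = a\<close> by (subst supp) (simp add: cinner_simps a_def)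
    finally show ?thesis by (simp add: outer_mult_vec vector_smult_assoc mult.commute)
  qed
  then have \<rho>: "\<rho> = outer (a *s p) p"
    by (simp add: matrix_eq)
  then have "a = 1"
    using tr assms(2) by (simp add: trace_outer cinner_simps)
  then show ?thesis using \<rho> by simp
qed

text \<open>The Bloch parametrization of the states of a qubit with orthonormal basis \<open>p\<close>, \<open>q\<close>: relative to that basis
this is the matrix \<open>(1 + x\<^sub>1 \<sigma>\<^sub>1 + x\<^sub>2 \<sigma>\<^sub>2 + x\<^sub>3 \<sigma>\<^sub>3) / 2\<close> with the Pauli matrices
\<open>\<sigma>\<^sub>i\<close>.\<close>

definition bloch :: "complex^'m \<Rightarrow> complex^'m \<Rightarrow> real^3 \<Rightarrow> complex^'m^'m" where
  "bloch p q x =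
     outer (complex_of_real ((1 + x $ 3) / 2) *s p) p + outer (Complex (x $ 1 / 2) (- x $ 2 / 2) *s p) q +
     outer (Complex (x $ 1 / 2) (x $ 2 / 2) *s q) p + outer (complex_of_real ((1 - x $ 3) / 2) *s q) q"

lemma affine_map_bloch: "affine_map (bloch p q)"
proof -
  define g where "g x =
     outer (complex_of_real (x $ 3 / 2) *s p) p + outer (Complex (x $ 1 / 2) (- x $ 2 / 2) *s p) q +
     outer (Complex (x $ 1 / 2) (x $ 2 / 2) *s q) p - outer (complex_of_real (x $ 3 / 2) *s q) q"
    for x :: "real^3"
  have "linear g"
    by (rule linearI)
      (simp_all add: g_def outer_def vec_eq_iff complex_eq_iff field_simps)
  moreover have "bloch p q = (\<lambda>x. g x + (outer ((1/2) *s p) p + outer ((1/2) *s q) q))"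
    by (rule ext)
      (simp add: bloch_def g_def outer_def vec_eq_iff add_divide_distrib diff_divide_distrib algebra_simps)
  ultimately show ?thesis
    unfolding affine_map_def by blast
qed

lemma norm_le_1_real3: "norm (x :: real^3) \<le> 1 \<longleftrightarrow> (x $ 1)\<^sup>2 + (x $ 2)\<^sup>2 + (x $ 3)\<^sup>2 \<le> 1"
  by (simp add: norm_vec_def L2_set_def sum_3)

text \<open>A hermitian 2 by 2 matrix with nonnegative diagonal entries and nonnegative determinant is positive
semi-definite.\<close>

lemma binary_form_nonneg:
  fixes a b :: real and c s t :: complex
  assumes "0 \<le> a" "0 \<le> b" "(cmod c)\<^sup>2 \<le> a * b"
  shows "0 \<le> a * (cmod s)\<^sup>2 + b * (cmod t)\<^sup>2 + 2 * Re (c * cnj s * t)"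
proof -
  have "cmod c \<le> sqrt a * sqrt b"
    using assms(3) by (metis real_le_rsqrt real_sqrt_mult)
  then have "cmod c * (cmod s * cmod t) \<le> sqrt a * sqrt b * (cmod s * cmod t)"
    by (intro mult_right_mono) simp_all
  moreover have "- Re (c * cnj s * t) \<le> cmod c * (cmod s * cmod t)"
    using abs_Re_le_cmod[of "c * cnj s * t"] by (simp add: norm_mult mult.assoc)
  moreover have "0 \<le> (sqrt a * cmod s - sqrt b * cmod t)\<^sup>2" by simp
  moreover have "(sqrt a * cmod s - sqrt b * cmod t)\<^sup>2 =
      a * (cmod s)\<^sup>2 + b * (cmod t)\<^sup>2 - 2 * (sqrt a * sqrt b * (cmod s * cmod t))"
    using assms(1,2) by (simp add: power2_diff power_mult_distrib)
  ultimately show ?thesis by linarith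
qed

text \<open>The unit ball condition on \<open>x\<close> is nonnegativity of the determinant of the 2 by 2 matrix:
\<open>4 det = 1 - x\<^sub>1\<^sup>2 - x\<^sub>2\<^sup>2 - x\<^sub>3\<^sup>2\<close>.\<close>

lemma bloch_density:
  assumes p: "cinner p p = 1" and q: "cinner q q = 1" and pq: "cinner p q = 0" and x: "x \<in> cball 0 1"
  shows "bloch p q x \<in> density_matrices"
proof -
  have qp: "cinner q p = 0"
    using pq cnj_cinner[of p q] by simp
  have "hermitian (bloch p q x)"
    unfolding hermitian_def by (simp add: bloch_def outer_def complex_eq_iff algebra_simps)
  moreover have "trace (bloch p q x) = 1"
    by (simp add: bloch_def trace_add trace_outer cinner_simps p q pq qp add_divide_distrib diff_divide_distrib)
  moreover have "0 \<le> Re (cinner v (bloch p q x *v v))" for v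
  proof -
    let ?c = "Complex (x $ 1 / 2) (- x $ 2 / 2)"
    define s t where "s = cinner p v" and "t = cinner q v"
    have st: "cinner v p = cnj s" "cinner v q = cnj t"
      by (simp_all add: s_def t_def)
    have ball: "(x $ 1)\<^sup>2 + (x $ 2)\<^sup>2 + (x $ 3)\<^sup>2 \<le> 1"
      using x by (simp add: norm_le_1_real3)
    then have "(x $ 3)\<^sup>2 \<le> 1"
      using zero_le_power2[of "x $ 1"] zero_le_power2[of "x $ 2"] by linarith
    then have x3: "\<bar>x $ 3\<bar> \<le> 1"
      by (simp add: abs_square_le_1)
    have "(cmod ?c)\<^sup>2 = ((x $ 1)\<^sup>2 + (x $ 2)\<^sup>2) / 4"
      unfolding cmod_power2 by (simp add: power_divide add_divide_distrib)
    moreover have "(1 + x $ 3) / 2 * ((1 - x $ 3) / 2) = (1 - (x $ 3)\<^sup>2) / 4"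
      by (simp add: power2_eq_square algebra_simps)
    ultimately have "(cmod ?c)\<^sup>2 \<le> (1 + x $ 3) / 2 * ((1 - x $ 3) / 2)"
      using ball by simp
    then have "0 \<le> (1 + x $ 3) / 2 * (cmod s)\<^sup>2 + (1 - x $ 3) / 2 * (cmod t)\<^sup>2 + 2 * Re (?c * cnj s * t)"
      using x3 by (intro binary_form_nonneg) auto
    also have "\<dots> = Re (cinner v (bloch p q x *v v))"
      unfolding cmod_power2
      by (simp add: bloch_def matrix_vector_mult_add_rdistrib outer_mult_vec cinner_simps st
          flip: s_def t_def) (simp add: power2_eq_square field_simps)
    finally show ?thesis .
  qed
  ultimately show ?thesis
    by (simp add: density_matrices_def pos_semidef_iff)
qed

text \<open>The matrix entries of \<open>\<rho>\<close> with respect to \<open>p\<close> and \<open>q\<close> determine \<open>\<rho>\<close>, since its range lies in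
their span and it is hermitian. The Bloch vector is read off from these entries, and its norm is bounded
through the Cauchy--Schwarz inequality for the form of \<open>\<rho>\<close>.\<close>

lemma density_supported_on_plane:
  assumes \<rho>: "\<rho> \<in> density_matrices" and p: "cinner p p = 1" and q: "cinner q q = 1" and pq: "cinner p q = 0"
    and supp: "\<And>v. \<rho> *v v = cinner p (\<rho> *v v) *s p + cinner q (\<rho> *v v) *s q"
  shows "\<rho> \<in> bloch p q ` cball 0 1"
proof -
  have qp: "cinner q p = 0"
    using pq cnj_cinner[of p q] by simp
  have psd: "pos_semidef \<rho>" and tr: "trace \<rho> = 1"
    using \<rho> by (auto simp: density_matrices_def)
  note herm = pos_semidef_imp_hermitian[OF psd]
  define a b c where "a = Re (cinner p (\<rho> *v p))" and "b = Re (cinner q (\<rho> *v q))"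
    and "c = cinner p (\<rho> *v q)"
  have pp: "cinner p (\<rho> *v p) = complex_of_real a" and qq: "cinner q (\<rho> *v q) = complex_of_real b"
    using hermitian_form_real[OF herm] by (simp_all add: a_def b_def)
  have cq: "cinner q (\<rho> *v p) = cnj c"
    using cinner_hermitian[OF herm, of p q] cnj_cinner[of "\<rho> *v p" q] by (simp add: c_def)
  have mv: "\<rho> *v v = cinner (\<rho> *v p) v *s p + cinner (\<rho> *v q) v *s q" for v
    using supp[of v] by (simp add: cinner_hermitian[OF herm])
  have \<rho>p: "\<rho> *v p = complex_of_real a *s p + cnj c *s q"
    using supp[of p] by (simp add: pp cq)
  have \<rho>q: "\<rho> *v q = c *s p + complex_of_real b *s q"
    using supp[of q] by (simp add: qq c_def)
  have \<rho>_eq: "\<rho> = outer (complex_of_real a *s p) p + outer (c *s p) q + outer (cnj c *s q) p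
      + outer (complex_of_real b *s q) q"
  proof -
    have "\<rho> *v v = (outer (complex_of_real a *s p) p + outer (c *s p) q + outer (cnj c *s q) p
      + outer (complex_of_real b *s q) q) *v v" for v
      unfolding mv[of v] \<rho>p \<rho>q
      by (simp add: matrix_vector_mult_add_rdistrib outer_mult_vec cinner_simps vec_eq_iff algebra_simps)
    then show ?thesis by (simp add: matrix_eq)
  qed
  have "complex_of_real (a + b) = 1"
    using tr by (subst (asm) \<rho>_eq) (simp add: trace_add trace_outer cinner_simps p q pq qp)
  then have ab: "a + b = 1" by (metis of_real_eq_1_iff)
  have CS: "(cmod c)\<^sup>2 \<le> a * b"
    unfolding a_def b_def c_def by (rule pos_semidef_Cauchy_Schwarz[OF psd])
  \<comment> \<open>The solution of \<open>a = (1 + x\<^sub>3) / 2\<close> and \<open>c = (x\<^sub>1 - \<i> x\<^sub>2) / 2\<close>, given \<open>a + b = 1\<close>.\<close>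
  define x :: "real^3" where "x = vector [2 * Re c, - 2 * Im c, a - b]"
  have "(2 * Re c)\<^sup>2 + (2 * Im c)\<^sup>2 + (a - b)\<^sup>2 = 4 * (cmod c)\<^sup>2 + (a - b)\<^sup>2"
    by (simp add: cmod_power2 power_mult_distrib)
  also have "\<dots> \<le> (a + b)\<^sup>2"
    using CS by (simp add: power2_eq_square algebra_simps)
  finally have "x \<in> cball 0 1"
    by (simp add: norm_le_1_real3 x_def ab)
  moreover have "\<rho> = bloch p q x"
  proof -
    have "(1 + x $ 3) / 2 = a" "(1 - x $ 3) / 2 = b"
      using ab by (simp_all add: x_def)
    moreover have "Complex (x $ 1 / 2) (- x $ 2 / 2) = c" "Complex (x $ 1 / 2) (x $ 2 / 2) = cnj c"
      by (simp_all add: x_def complex_eq_iff)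
    ultimately show ?thesis
      unfolding bloch_def by (subst \<rho>_eq) simp
  qed
  ultimately show ?thesis by blast
qed

text \<open>For a kernel of dimension one the set is a single point, which is covered by a constant affine map, so the
two possible dimensions need not be told apart afterwards.\<close>

lemma density_kernel_eq_affine_image_cball:
  fixes H :: "complex^3^3"
  assumes H: "pos_semidef H" "H \<noteq> 0"
    and ne: "\<exists>\<rho>\<in>density_matrices. Re (trace (H ** \<rho>)) = 0"
  shows "\<exists>f :: real^3 \<Rightarrow> complex^3^3. affine_map f \<and>
    {\<rho> \<in> density_matrices. Re (trace (H ** \<rho>)) = 0} = f ` cball 0 1"
proof -
  let ?S = "{\<rho> \<in> density_matrices. Re (trace (H ** \<rho>)) = 0}"
  have ker: "H *v (\<rho> *v v) = 0" if "\<rho> \<in> ?S" for \<rho> v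
    using pos_semidef_mult_eq_0[OF H(1), of \<rho>] that
    by (simp add: density_matrices_def matrix_vector_mul_assoc)
  obtain \<rho>0 where \<rho>0: "\<rho>0 \<in> ?S" using ne by blast
  have "\<rho>0 \<noteq> 0"
    using \<rho>0 by (auto simp: density_matrices_def trace_def)
  then obtain v0 where "\<rho>0 *v v0 \<noteq> 0"
    using matrix_eq[of \<rho>0 0] by auto
  with pos_semidef_imp_hermitian[OF H(1)] H(2) ker[OF \<rho>0, of v0]
  show ?thesis
  proof (cases rule: kernel_hermitian_3_cases)
    case (line p)
    have "outer p p \<in> ?S"
      using outer_self_density line by (simp add: trace_outer_mult)
    then have "?S = {outer p p}"
      using density_supported_on_line line(1) line(3)[OF ker] by blast
    also have "\<dots> = (\<lambda>x::real^3. outer p p) ` cball 0 1"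
      by (simp add: image_constant_conv)
    finally show ?thesis
      using affine_map_const by blast
  next
    case (plane p q)
    have "?S \<subseteq> bloch p q ` cball 0 1"
    proof
      fix \<rho> assume "\<rho> \<in> ?S"
      then show "\<rho> \<in> bloch p q ` cball 0 1"
        by (intro density_supported_on_plane plane(1-3) plane(6)[OF ker]) simp
    qed
    moreover have "H ** bloch p q x = 0" for x
      by (simp add: bloch_def matrix_add_ldistrib matrix_mult_outer vector_scalar_commute plane(4,5))
        (simp add: outer_def vec_eq_iff)
    then have "bloch p q ` cball 0 1 \<subseteq> ?S"
      using bloch_density plane(1-3) by (auto simp: trace_def)
    ultimately have "?S = bloch p q ` cball 0 1" by blast
    then show ?thesis using affine_map_bloch by blast
  qed
qed

section \<open>Faces of the joint numerical range\<close>

lemma trace_scaleR: "trace (r *\<^sub>R A) = r *\<^sub>R trace A" for A :: "complex^'m^'m"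
  by (simp add: trace_def scaleR_sum_right)

lemma linear_Re_trace_mult: "linear (\<lambda>X. Re (trace (X ** A)))" for A :: "complex^'m^'m"
proof -
  have "A ** (r *\<^sub>R X) = r *\<^sub>R (A ** X)" for r and X :: "complex^'m^'m"
    by (simp add: matrix_matrix_mult_def vec_eq_iff scaleR_sum_right)
  then have "linear (\<lambda>X. Re (trace (A ** X)))"
    by (intro linearI) (simp_all add: matrix_add_ldistrib trace_add trace_scaleR)
  moreover have "trace (X ** A) = trace (A ** X)" for X :: "complex^'m^'m"
    by (rule trace_mul_sym)
  ultimately show ?thesis by presburger
qed

lemma trace_mult_hermitian_real:
  assumes A: "hermitian A" and B: "hermitian B"
  shows "trace (A ** B) = complex_of_real (Re (trace (A ** B)))"
proof -
  have "cnj (A $ i $ j) = A $ j $ i" "cnj (B $ i $ j) = B $ j $ i" for i j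
    using A B by (simp_all add: hermitian_cnj)
  then have "cnj (trace (A ** B)) = (\<Sum>i\<in>UNIV. \<Sum>k\<in>UNIV. A $ k $ i * B $ i $ k)"
    by (simp add: trace_def matrix_matrix_mult_def)
  also have "\<dots> = trace (A ** B)"
    by (subst sum.swap) (simp add: trace_def matrix_matrix_mult_def)
  finally show ?thesis
    by (metis Reals_cnj_iff of_real_Re)
qed

lemma hermitian_diff_scaleR_sum:
  assumes "\<And>i. hermitian (F i)"
  shows "hermitian (b *\<^sub>R mat 1 - (\<Sum>i\<in>I. a i *\<^sub>R F i))"
proof -
  have "cnj (F i $ j $ k) = F i $ k $ j" for i j k
    using assms by (rule hermitian_cnj)
  then show ?thesis
    unfolding hermitian_def by (simp add: mat_def sum_component)
qed

lemma convex_density_matrices: "convex density_matrices"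
proof (rule convexI)
  fix A B :: "complex^'a^'a" and u v :: real
  assume A: "A \<in> density_matrices" and B: "B \<in> density_matrices" and u: "0 \<le> u" and v: "0 \<le> v" and uv: "u + v = 1"
  have "hermitian A" "hermitian B"
    using A B by (simp_all add: density_matrices_def pos_semidef_iff)
  then have "cnj (A $ i $ j) = A $ j $ i" "cnj (B $ i $ j) = B $ j $ i" for i j
    by (simp_all add: hermitian_cnj)
  then have "hermitian (u *\<^sub>R A + v *\<^sub>R B)"
    by (simp add: hermitian_def)
  moreover have "cinner x ((u *\<^sub>R A + v *\<^sub>R B) *v x) = u *\<^sub>R cinner x (A *v x) + v *\<^sub>R cinner x (B *v x)" for x
    by (simp add: cinner_def matrix_vector_mult_def sum.distrib scaleR_sum_right sum_distrib_left
        algebra_simps)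
  moreover have "trace (u *\<^sub>R A + v *\<^sub>R B) = 1"
    using A B uv
    by (simp add: density_matrices_def trace_add trace_scaleR flip: scaleR_add_left)
  ultimately show "u *\<^sub>R A + v *\<^sub>R B \<in> density_matrices"
    using A B u v by (simp add: density_matrices_def pos_semidef_iff)
qed

definition moment_map :: "(complex^'m^'m)^'n \<Rightarrow> complex^'m^'m \<Rightarrow> real^'n" where
  "moment_map F \<rho> = (\<chi> i. Re (trace (\<rho> ** F $ i)))"

lemma linear_moment_map: "linear (moment_map F)"
  by (rule linearI)
    (simp_all add: moment_map_def vec_eq_iff linear_add[OF linear_Re_trace_mult]
      linear_scale[OF linear_Re_trace_mult])

lemma joint_num_range_eq_image:
  fixes F :: "(complex^'m^'m)^'n"
  assumes "\<And>i. hermitian (F $ i)"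
  shows "joint_num_range F = moment_map F ` density_matrices"
proof -
  have "(\<forall>i. complex_of_real (x $ i) = trace (\<rho> ** F $ i)) \<longleftrightarrow> x = moment_map F \<rho>"
    if "\<rho> \<in> density_matrices" for \<rho> and x
  proof -
    have "hermitian \<rho>"
      using that by (simp add: density_matrices_def pos_semidef_iff)
    then have "trace (\<rho> ** F $ i) = complex_of_real (moment_map F \<rho> $ i)" for i
      using trace_mult_hermitian_real[OF _ assms] by (simp add: moment_map_def)
    then show ?thesis by (simp add: vec_eq_iff)
  qed
  then show ?thesis
    unfolding joint_num_range_def image_def by auto
qed

lemma convex_joint_num_range:
  assumes "\<And>i. hermitian (F $ i)"
  shows "convex (joint_num_range F)"
  unfolding joint_num_range_eq_image[OF assms]
  by (intro convex_linear_image linear_moment_map convex_density_matrices)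

text \<open>Affine functionals on the range correspond to matrices of the pencil spanned by the identity and the
\<open>F\<^sub>i\<close>; this uses that a density matrix has trace one.\<close>

lemma Re_trace_pencil:
  assumes "\<rho> \<in> density_matrices"
  shows "Re (trace ((b *\<^sub>R mat 1 - (\<Sum>i\<in>UNIV. a $ i *\<^sub>R F $ i)) ** \<rho>)) = b - a \<bullet> moment_map F \<rho>"
proof -
  note lin = linear_Re_trace_mult[of \<rho>]
  have "Re (trace (mat 1 ** \<rho>)) = 1"
    using assms by (simp add: density_matrices_def)
  moreover have "Re (trace (F $ i ** \<rho>)) = moment_map F \<rho> $ i" for i
    unfolding moment_map_def by (subst trace_mul_sym) simp
  ultimately show ?thesis
    by (simp add: linear_diff[OF lin] linear_scale[OF lin] linear_sum[OF lin] inner_vec_def)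
qed

lemma exposed_face_eq_affine_image_cball:
  fixes F :: "(complex^3^3)^'n"
  assumes herm: "\<And>i. hermitian (F $ i)"
    and le: "joint_num_range F \<subseteq> {x. a \<bullet> x \<le> b}"
    and ne: "joint_num_range F \<inter> {x. a \<bullet> x = b} \<noteq> {}"
    and proper: "\<not> joint_num_range F \<subseteq> {x. a \<bullet> x = b}"
  shows "\<exists>f :: real^3 \<Rightarrow> real^'n. affine_map f \<and> joint_num_range F \<inter> {x. a \<bullet> x = b} = f ` cball 0 1"
proof -
  let ?L = "joint_num_range F" and ?\<pi> = "moment_map F"
  define H where "H = b *\<^sub>R mat 1 - (\<Sum>i\<in>UNIV. a $ i *\<^sub>R F $ i)"
  have L: "?L = ?\<pi> ` density_matrices"
    by (rule joint_num_range_eq_image[OF herm])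
  have trH: "Re (trace (H ** \<rho>)) = b - a \<bullet> ?\<pi> \<rho>" if "\<rho> \<in> density_matrices" for \<rho>
    unfolding H_def by (rule Re_trace_pencil[OF that])
  have "hermitian H"
    unfolding H_def by (rule hermitian_diff_scaleR_sum[OF herm])
  then have psd: "pos_semidef H"
    using le by (intro pos_semidefI_density) (auto simp: trH L)
  have "H \<noteq> 0"
  proof
    assume "H = 0"
    then have "b = a \<bullet> ?\<pi> \<rho>" if "\<rho> \<in> density_matrices" for \<rho>
      using trH[OF that] by (simp add: trace_def)
    then show False using proper by (auto simp: L)
  qed
  moreover have E: "?L \<inter> {x. a \<bullet> x = b} = ?\<pi> ` {\<rho> \<in> density_matrices. Re (trace (H ** \<rho>)) = 0}"
    by (auto simp: L trH)
  moreover have "\<exists>\<rho>\<in>density_matrices. Re (trace (H ** \<rho>)) = 0"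
    using ne E by blast
  ultimately obtain f :: "real^3 \<Rightarrow> complex^3^3" where f: "affine_map f"
      "{\<rho> \<in> density_matrices. Re (trace (H ** \<rho>)) = 0} = f ` cball 0 1"
    using density_kernel_eq_affine_image_cball[OF psd] by blast
  have "?L \<inter> {x. a \<bullet> x = b} = (\<lambda>x. ?\<pi> (f x)) ` cball 0 1"
    unfolding E f(2) image_image ..
  moreover have "affine_map (\<lambda>x. ?\<pi> (f x))"
    by (rule affine_map_compose[OF linear_affine_map[OF linear_moment_map] f(1)])
  ultimately show ?thesis by blast
qed

theorem lemma4p3:
  fixes F :: "(complex^3^3)^'n"
  assumes "\<And>i. hermitian (F $ i)"
  shows "\<forall>T. T proper_face_of joint_num_range F \<longrightarrow>
    ((\<exists>a. T = {a}) \<or> (\<exists>a b. a \<noteq> b \<and> T = closed_segment a b) \<or>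
      filled_ellipse T \<or> filled_ellipsoid T) \<and>
    ((\<nexists>a. T = {a}) \<longrightarrow> T exposed_face_of joint_num_range F)"
proof (intro allI impI)
  fix T assume T: "T proper_face_of joint_num_range F"
  let ?L = "joint_num_range F"
  have T': "T face_of ?L" "T \<noteq> {}" "T \<subseteq> ?L"
    using T face_of_imp_subset by (auto simp: proper_face_of_def)
  have conv: "convex ?L"
    by (rule convex_joint_num_range[OF assms])
  then obtain a b where ab: "?L \<subseteq> {x. a \<bullet> x \<le> b}" "T \<subseteq> {x. a \<bullet> x = b}" "\<not> ?L \<subseteq> {x. a \<bullet> x = b}"
    using T by (rule proper_face_subset_proper_exposed_face)
  let ?E = "?L \<inter> {x. a \<bullet> x = b}"
  have exposed: "?E exposed_face_of ?L"
    using ab(1) by (intro exposed_face_of_Int_supporting_hyperplane_le conv) blast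
  have TE: "T \<subseteq> ?E" and "?E \<noteq> {}"
    using T' ab(2) by auto
  then obtain f :: "real^3 \<Rightarrow> real^'n" where f: "affine_map f" "?E = f ` cball 0 1"
    using exposed_face_eq_affine_image_cball[OF assms ab(1) _ ab(3)] by blast
  show "((\<exists>a. T = {a}) \<or> (\<exists>a b. a \<noteq> b \<and> T = closed_segment a b) \<or>
      filled_ellipse T \<or> filled_ellipsoid T) \<and>
    ((\<nexists>a. T = {a}) \<longrightarrow> T exposed_face_of ?L)"
  proof (cases "T = ?E")
    case True
    then show ?thesis
      using exposed affine_image_cball3_cases[OF f(1)] by (simp only: f(2) simp_thms)
  next
    case False
    have "T face_of ?E"
      using T'(1) TE by (rule face_of_subset) simp
    then have "T proper_face_of f ` cball 0 1"
      using False T'(2) by (simp add: proper_face_of_def f(2))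
    from proper_face_of_affine_image_cball[OF f(1) this]
    show ?thesis by blast
  qed
qed

end
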